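(* Let $\mathbb{X}$ be a real Banach space with dual $\mathbb{X}^{\ast}$ and let $\varphi:\mathbb{X}\rightarrow\,]-\infty,+\infty]$ be a proper convex lower semicontinuous function. Then the subdifferential $\partial\varphi:\mathbb{X}\rightrightarrows\mathbb{X}^{\ast}$ is a proper maximal monotone operator.
   Context: $\langle x,x^{\ast}\rangle=\langle x^{\ast},x\rangle$ denotes the value $x^{\ast}(x)$ of $x^{\ast}\in\mathbb{X}^{\ast}$ at $x\in\mathbb{X}$. A function $\varphi:\mathbb{X}\to\,]-\infty,+\infty]$ is proper if $\{x\in\mathbb{X}:\varphi(x)<\infty\}\neq\emptyset$. The subdifferential $\partial\varphi:\mathbb{X}\rightrightarrows\mathbb{X}^{\ast}$ is the point-to-set operator defined by: $x^{\ast}\in\partial\varphi(x)$ if $\langle y-x,x^{\ast}\rangle+\varphi(x)\leq\varphi(y)$ for all $y\in\mathbb{X}$. A point-to-set operator $A:\mathbb{X}\rightrightarrows\mathbb{X}^{\ast}$ assigns to each $x\in\mathbb{X}$ a subset $A(x)\subset\mathbb{X}^{\ast}$ and is identified with its graph $\{(x,x^{\ast})\in\mathbb{X}\times\mathbb{X}^{\ast}:x^{\ast}\in A(x)\}$. It is proper if $A(x)\neq\emptyset$ for some $x\in\mathbb{X}$. It is monotone if $\langle x-y,x^{\ast}-y^{\ast}\rangle\geq0$ for all $(x,x^{\ast}),(y,y^{\ast})\in A$. A monotone operator is maximal monotone if its graph is not properly contained in the graph of any other monotone operator; equivalently, for a monotone $A$, whenever $(x,x^{\ast})\in\mathbb{X}\times\mathbb{X}^{\ast}$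 satisfies $\langle x-u,x^{\ast}-u^{\ast}\rangle\geq0$ for all $(u,u^{\ast})\in A$, one has $(x,x^{\ast})\in A$. *)

theory Defs
  imports "HOL-Analysis.Analysis"
begin

(* The topological dual of 'a is the type of bounded linear maps from 'a to real;
   the pairing of x with xs is blinfun_apply xs x. *)
type_synonym 'a dual = "'a \<Rightarrow>\<^sub>L real"

text \<open>Functions into \<open>]-\<infinity>, +\<infinity>]\<close> are \<^typ>\<open>ereal\<close>-valued functions that avoid \<open>-\<infinity>\<close>.\<close>

definition never_minus_infinity :: "('a \<Rightarrow> ereal) \<Rightarrow> bool" where
  "never_minus_infinity \<phi> \<longleftrightarrow> (\<forall>x. \<phi> x \<noteq> -\<infinity>)"

definition proper_function :: "('a \<Rightarrow> ereal) \<Rightarrow> bool" where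
  "proper_function \<phi> \<longleftrightarrow> {x. \<phi> x < \<infinity>} \<noteq> {}"

(* Mirrors convex_on, which is restricted to real-valued functions. When \<phi> avoids -\<infinity>,
   no sum of opposite infinities occurs; ereal has 0 * \<infinity> = 0, so the cases u = 0 and
   v = 0 are harmless. *)
definition convex_function :: "('a::real_vector \<Rightarrow> ereal) \<Rightarrow> bool" where
  "convex_function \<phi> \<longleftrightarrow>
    (\<forall>x y. \<forall>u\<ge>0. \<forall>v\<ge>0. u + v = 1 \<longrightarrow>
      \<phi> (u *\<^sub>R x + v *\<^sub>R y) \<le> ereal u * \<phi> x + ereal v * \<phi> y)"

definition lower_semicontinuous :: "('a::topological_space \<Rightarrow> ereal) \<Rightarrow> bool" where
  "lower_semicontinuous \<phi> \<longleftrightarrow> (\<forall>x. \<phi> x \<le> Liminf (at x) \<phi>)"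

definition subdifferential :: "('a::real_normed_vector \<Rightarrow> ereal) \<Rightarrow> 'a \<Rightarrow> 'a dual set" where
  "subdifferential \<phi> x = {xs. \<forall>y. ereal (blinfun_apply xs (y - x)) + \<phi> x \<le> \<phi> y}"

definition operator_graph :: "('a \<Rightarrow> 'b set) \<Rightarrow> ('a \<times> 'b) set" where
  "operator_graph A = {(x, xs). xs \<in> A x}"

definition proper_operator :: "('a \<Rightarrow> 'b set) \<Rightarrow> bool" where
  "proper_operator A \<longleftrightarrow> (\<exists>x. A x \<noteq> {})"

definition monotone_operator :: "('a::real_normed_vector \<Rightarrow> 'a dual set) \<Rightarrow> bool" where
  "monotone_operator A \<longleftrightarrow>
    (\<forall>(x, xs) \<in> operator_graph A. \<forall>(y, ys) \<in> operator_graph A.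
      0 \<le> blinfun_apply (xs - ys) (x - y))"

definition maximal_monotone_operator :: "('a::real_normed_vector \<Rightarrow> 'a dual set) \<Rightarrow> bool" where
  "maximal_monotone_operator A \<longleftrightarrow>
    monotone_operator A \<and>
    \<not> (\<exists>B. monotone_operator B \<and> operator_graph A \<subset> operator_graph B)"

end

theory Submission
  imports Defs
begin

text \<open>
  Let \<open>(p, w)\<close> be monotonically related to the graph of \<open>\<partial>\<phi>\<close>. The idea is to approximate it by
  points of that graph obtained from a coercive perturbation of \<open>\<phi>\<close>. The function
  \<open>\<phi> y + 1/2 \<parallel>y - p\<parallel>\<^sup>2 - w (y - p)\<close> is lower semicontinuous and bounded below, so Ekeland's principle
  gives, for every \<open>\<epsilon> > 0\<close>, a point \<open>x\<close> that minimises it after \<open>\<epsilon> \<parallel>y - x\<parallel>\<close> has been added. The added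
  terms are finite and convex, so a Hahn-Banach sandwich argument splits the minimality of \<open>x\<close> into a
  subgradient \<open>u\<close> of \<open>\<phi>\<close> at \<open>x\<close> and the opposite subgradient of the added terms. The latter forces
  \<open>(u - w) (x - p) \<le> \<epsilon> \<parallel>x - p\<parallel> - \<parallel>x - p\<parallel>\<^sup>2\<close> and \<open>\<parallel>u - w\<parallel> \<le> \<parallel>x - p\<parallel> + \<epsilon>\<close>
  (lemma \<open>approximate_resolvent\<close>). In particular subgradients exist.

  Monotonicity makes the left-hand side of the first estimate nonnegative, whence
  \<open>\<parallel>x - p\<parallel> \<le> \<epsilon>\<close> and \<open>\<parallel>u - w\<parallel> \<le> 2 \<epsilon>\<close>. As \<open>\<epsilon> \<rightarrow> 0\<close>, the pairs \<open>(x, u)\<close> converge in norm to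
  \<open>(p, w)\<close>, and since the epigraph of \<open>\<phi>\<close> is closed the subgradient inequality passes to the limit:
  \<open>w \<in> \<partial>\<phi>(p)\<close> (lemma \<open>monotonically_related_subgradient\<close>).

  Except at the two ends, \<open>\<phi>\<close> is represented by its effective domain \<open>D\<close> and a real-valued \<open>f\<close>
  on \<open>D\<close>; lower semicontinuity of \<open>\<phi>\<close> on the whole space is closedness of
  \<open>{(x, r). x \<in> D \<and> f x \<le> r}\<close>.
\<close>

section \<open>Linear minorants of convex functions\<close>

text \<open>One construction serves three times below: the infimum of a chain of convex functions, the infimal
  convolution of a convex function with a line, and that of two convex functions are all pointwise
  infima of families with this joint convexity property. Taking \<open>d' = - d\<close> and equal weights in that
  property bounds every \<open>F i d\<close> below by \<open>- F j (- d)\<close>, so that the infimum is finite.\<close>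

lemma directed_infimum_convex:
  fixes F :: "'i \<Rightarrow> 'a::real_vector \<Rightarrow> real"
  assumes ne: "I \<noteq> {}"
    and dir: "\<And>i j d d' u v. i \<in> I \<Longrightarrow> j \<in> I \<Longrightarrow> 0 \<le> u \<Longrightarrow> 0 \<le> v \<Longrightarrow> u + v = 1 \<Longrightarrow>
      \<exists>l\<in>I. F l (u *\<^sub>R d + v *\<^sub>R d') \<le> u * F i d + v * F j d'"
    and nonneg: "\<And>i. i \<in> I \<Longrightarrow> 0 \<le> F i 0"
  obtains K where "convex_on UNIV K" "0 \<le> K 0" "\<And>i d. i \<in> I \<Longrightarrow> K d \<le> F i d"
proof
  define K where "K d = (INF i\<in>I. F i d)" for d
  obtain j where j: "j \<in> I" using ne by blast
  have "- F j (- d) \<le> F i d" if i: "i \<in> I" for i d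
  proof -
    obtain l where "l \<in> I" "F l ((1/2) *\<^sub>R d + (1/2) *\<^sub>R (- d)) \<le> 1/2 * F i d + 1/2 * F j (- d)"
      using dir[OF i j, of "1/2" "1/2" d "- d"] by auto
    with nonneg[of l] show ?thesis by simp
  qed
  then have bdd: "bdd_below ((\<lambda>i. F i d) ` I)" for d
    by (intro bdd_belowI2)
  show K_le: "K d \<le> F i d" if "i \<in> I" for i d
    unfolding K_def using bdd that by (rule cINF_lower)
  show "0 \<le> K 0"
    unfolding K_def using ne nonneg by (intro cINF_greatest)
  show "convex_on UNIV K"
    unfolding convex_on_def
  proof (intro conjI ballI allI impI)
    fix d d' :: 'a and u v :: real
    assume uv: "0 \<le> u" "0 \<le> v" "u + v = 1"
    show "K (u *\<^sub>R d + v *\<^sub>R d') \<le> u * K d + v * K d'"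
    proof (rule field_le_epsilon)
      fix e :: real
      assume e: "0 < e"
      obtain i where i: "i \<in> I" "F i d < K d + e"
        using cINF_less_iff[OF ne bdd, of d "K d + e"] e by (auto simp: K_def)
      obtain j where j: "j \<in> I" "F j d' < K d' + e"
        using cINF_less_iff[OF ne bdd, of d' "K d' + e"] e by (auto simp: K_def)
      obtain l where l: "l \<in> I" "F l (u *\<^sub>R d + v *\<^sub>R d') \<le> u * F i d + v * F j d'"
        using dir[OF i(1) j(1) uv] by blast
      have "K (u *\<^sub>R d + v *\<^sub>R d') \<le> u * F i d + v * F j d'"
        using K_le[OF l(1)] l(2) by (rule order_trans)
      also have "\<dots> \<le> u * (K d + e) + v * (K d' + e)"
        using i(2) j(2) uv by (intro add_mono mult_left_mono) auto
      also have "\<dots> = u * K d + v * K d' + (u + v) * e"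
        by (simp add: algebra_simps)
      finally show "K (u *\<^sub>R d + v *\<^sub>R d') \<le> u * K d + v * K d' + e"
        using uv by simp
    qed
  qed simp
qed

text \<open>A line through the origin supports a convex function of one real variable that is nonnegative
  at \<open>0\<close>: every slope \<open>k (t a) / t\<close> with \<open>t > 0\<close> is at least every slope with \<open>t < 0\<close>, because \<open>0\<close> is a convex
  combination of the two base points.\<close>

lemma convex_line_slope:
  fixes k :: "'a::real_vector \<Rightarrow> real"
  assumes conv: "convex_on UNIV k" and k0: "0 \<le> k 0"
  obtains m where "\<And>t. t * m \<le> k (t *\<^sub>R a)"
proof
  define m where "m = (INF t\<in>{0<..}. k (t *\<^sub>R a) / t)"
  have chord: "- k (- (s *\<^sub>R a)) / s \<le> k (t *\<^sub>R a) / t" if s: "0 < s" and t: "0 < t" for s t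
  proof -
    have 0: "(s / (s + t)) *\<^sub>R (t *\<^sub>R a) + (t / (s + t)) *\<^sub>R (- (s *\<^sub>R a)) = 0"
      by (simp add: mult.commute)
    have "0 \<le> k ((s / (s + t)) *\<^sub>R (t *\<^sub>R a) + (t / (s + t)) *\<^sub>R (- (s *\<^sub>R a)))"
      unfolding 0 by (rule k0)
    also have "\<dots> \<le> s / (s + t) * k (t *\<^sub>R a) + t / (s + t) * k (- (s *\<^sub>R a))"
    proof -
      have "s / (s + t) + t / (s + t) = 1"
        using s t by (simp add: add_divide_distrib[symmetric])
      then show ?thesis
        using s t by (intro conv[unfolded convex_on_def, THEN conjunct2, rule_format]) auto
    qed
    also have "\<dots> = (s * k (t *\<^sub>R a) + t * k (- (s *\<^sub>R a))) / (s + t)"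
      by (simp add: add_divide_distrib)
    finally have "0 \<le> s * k (t *\<^sub>R a) + t * k (- (s *\<^sub>R a))"
      using s t by (simp add: zero_le_divide_iff)
    then show ?thesis using s t by (simp add: field_simps)
  qed
  fix t :: real
  consider "t = 0" | "0 < t" | "t < 0" by linarith
  then show "t * m \<le> k (t *\<^sub>R a)"
  proof cases
    case 1
    then show ?thesis using k0 by simp
  next
    case 2
    have "bdd_below ((\<lambda>t. k (t *\<^sub>R a) / t) ` {0<..})"
      using chord[of 1] by (intro bdd_belowI2[where m = "- k (- (1 *\<^sub>R a)) / 1"]) auto
    then have "m \<le> k (t *\<^sub>R a) / t"
      unfolding m_def using 2 by (intro cINF_lower) auto
    then show ?thesis using 2 by (simp add: field_simps)
  next
    case 3
    have "- k (- ((- t) *\<^sub>R a)) / (- t) \<le> m"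
      unfolding m_def using 3 by (intro cINF_greatest chord) auto
    then show ?thesis using 3 by (simp add: field_simps)
  qed
qed

text \<open>The Hahn-Banach theorem with a convex instead of a sublinear majorant. Zorn's lemma is applied to the
  majorant rather than to partially defined functionals: a minimal convex function that is
  nonnegative at \<open>0\<close> has to be linear, for otherwise infimal convolution with a supporting line in some direction
  would make it smaller.\<close>

theorem Hahn_Banach_convex:
  fixes K :: "'a::real_vector \<Rightarrow> real"
  assumes conv: "convex_on UNIV K" and K0: "0 \<le> K 0"
  obtains g where "linear g" "\<And>d. g d \<le> K d"
proof -
  define A where "A = {k. convex_on UNIV k \<and> 0 \<le> k 0 \<and> k \<le> K}"
  have "\<exists>k\<in>A. \<forall>l\<in>A. l \<le> k \<longrightarrow> l = k"
  proof (rule predicate_Zorn)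
    show "partial_order_on A (relation_of (\<lambda>k l. l \<le> k) A)"
      by (rule partial_order_on_relation_ofI) auto
  next
    fix C
    assume C: "C \<in> Chains (relation_of (\<lambda>k l. l \<le> k) A)"
    then have CA: "k \<in> A" if "k \<in> C" for k
      using that by (auto simp: Chains_def relation_of_def)
    have total: "k \<le> l \<or> l \<le> k" if "k \<in> C" "l \<in> C" for k l
      using C that by (auto simp: Chains_def relation_of_def)
    show "\<exists>u\<in>A. \<forall>k\<in>C. u \<le> k"
    proof (cases "C = {}")
      case True
      then show ?thesis using conv K0 by (auto simp: A_def)
    next
      case False
      have dir: "\<exists>m\<in>C. m (a *\<^sub>R d + b *\<^sub>R d') \<le> a * k d + b * l d'"
        if kl: "k \<in> C" "l \<in> C" and ab: "0 \<le> a" "0 \<le> b" "a + b = 1" for k l d d' a b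
      proof -
        obtain m where m: "m \<in> C" "m \<le> k" "m \<le> l"
          using total[OF kl] kl by blast
        have "m (a *\<^sub>R d + b *\<^sub>R d') \<le> a * m d + b * m d'"
          using CA[OF m(1)] ab by (simp add: A_def convex_on_def)
        also have "\<dots> \<le> a * k d + b * l d'"
          using m ab by (intro add_mono mult_left_mono) (auto simp: le_fun_def)
        finally show ?thesis using m(1) by blast
      qed
      obtain u where u: "convex_on UNIV u" "0 \<le> u 0" "\<And>k d. k \<in> C \<Longrightarrow> u d \<le> k d"
        by (rule directed_infimum_convex[where F = "\<lambda>k. k" and I = C])
          (use False dir CA in \<open>auto simp: A_def\<close>)
      obtain k where k: "k \<in> C" using False by blast
      have "u \<le> k" using u(3)[OF k] by (simp add: le_fun_def)
      also have "k \<le> K" using CA[OF k] by (simp add: A_def)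
      finally have "u \<in> A" using u by (simp add: A_def)
      then show ?thesis using u(3) by (auto simp: le_fun_def)
    qed
  qed
  then obtain k where k: "convex_on UNIV k" "0 \<le> k 0" "k \<le> K"
    and min: "\<And>l. convex_on UNIV l \<Longrightarrow> 0 \<le> l 0 \<Longrightarrow> l \<le> k \<Longrightarrow> l = k"
    unfolding A_def by (auto intro: order_trans)
  \<comment> \<open>Lowering \<open>k\<close> by the constant \<open>k 0\<close> keeps it admissible, so minimality gives \<open>k 0 = 0\<close>.\<close>
  have "(\<lambda>d. k d - k 0) = k"
  proof (rule min)
    show "convex_on UNIV (\<lambda>d. k d - k 0)"
      using k(1) by (intro convex_on_diff) (auto simp: concave_on_const)
  qed (use k(2) in \<open>auto simp: le_fun_def\<close>)
  then have zero: "k 0 = 0" by (auto dest: fun_cong[where x = 0])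
  have affine: "k (d + t *\<^sub>R a) = k d + t * k a" for d a t
  proof -
    obtain m where m: "\<And>t. t * m \<le> k (t *\<^sub>R a)"
      using convex_line_slope[OF k(1,2)] by blast
    have dir: "\<exists>l\<in>UNIV. k (u *\<^sub>R d + v *\<^sub>R d' + l *\<^sub>R a) - l * m
        \<le> u * (k (d + s *\<^sub>R a) - s * m) + v * (k (d' + t *\<^sub>R a) - t * m)"
      if uv: "0 \<le> u" "0 \<le> v" "u + v = 1" for s t d d' u v
    proof
      have "k (u *\<^sub>R (d + s *\<^sub>R a) + v *\<^sub>R (d' + t *\<^sub>R a))
          \<le> u * k (d + s *\<^sub>R a) + v * k (d' + t *\<^sub>R a)"
        using k(1) uv by (simp add: convex_on_def)
      then show "k (u *\<^sub>R d + v *\<^sub>R d' + (u * s + v * t) *\<^sub>R a) - (u * s + v * t) * m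
        \<le> u * (k (d + s *\<^sub>R a) - s * m) + v * (k (d' + t *\<^sub>R a) - t * m)"
        by (simp add: algebra_simps)
    qed simp
    \<comment> \<open>The infimal convolution of \<open>k\<close> with the line of slope \<open>m\<close> along \<open>a\<close>; it lies below \<open>k\<close>.\<close>
    obtain l where l: "convex_on UNIV l" "0 \<le> l 0" "\<And>t d. l d \<le> k (d + t *\<^sub>R a) - t * m"
      by (rule directed_infimum_convex[where F = "\<lambda>t d. k (d + t *\<^sub>R a) - t * m" and I = UNIV])
        (use dir m in auto)
    have "l = k"
      using l(3)[of _ 0] by (intro min l) (simp add: le_fun_def)
    then have le: "k d \<le> k (d + t *\<^sub>R a) - t * m" for d t
      using l(3) by simp
    \<comment> \<open>The reverse inequality is the same one read from \<open>d + t a\<close> with step \<open>- t\<close>.\<close>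
    have eq: "k (d + t *\<^sub>R a) = k d + t * m" for d t
      using le[of d t] le[of "d + t *\<^sub>R a" "- t"] by simp
    from eq[of 0 1] have "m = k a" using zero by simp
    then show ?thesis using eq by simp
  qed
  have "linear k"
    using affine[of _ 1] affine[of 0] zero by (intro linearI) auto
  then show thesis using k(3) that by (auto simp: le_fun_def)
qed

text \<open>The subdifferential sum rule at a minimiser of \<open>f + h\<close>, with \<open>h\<close> finite everywhere: \<open>g\<close> is a subgradient
  of \<open>f\<close> and \<open>- g\<close> one of \<open>h\<close>. Both inequalities say that \<open>g\<close> lies below the function
  \<open>d \<mapsto> inf\<^sub>y (f y + h (y - d)) - (f x + h x)\<close>, which is convex, finite because \<open>h\<close> is, and nonnegative
  at \<open>0\<close> because \<open>x\<close> is a minimiser.\<close>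

lemma convex_sandwich:
  fixes f h :: "'a::real_vector \<Rightarrow> real"
  assumes f: "convex_on D f" and h: "convex_on UNIV h" and x: "x \<in> D"
    and min: "\<And>y. y \<in> D \<Longrightarrow> f x + h x \<le> f y + h y"
  obtains g where "linear g" "\<And>y. y \<in> D \<Longrightarrow> f x + g (y - x) \<le> f y"
    "\<And>y. h x - g (y - x) \<le> h y"
proof -
  have dir: "\<exists>z\<in>D. f z + h (z - (u *\<^sub>R d + v *\<^sub>R d')) - (f x + h x)
      \<le> u * (f y + h (y - d) - (f x + h x)) + v * (f y' + h (y' - d') - (f x + h x))"
    if y: "y \<in> D" "y' \<in> D" and uv: "0 \<le> u" "0 \<le> v" "u + v = 1" for y y' d d' u v
  proof
    let ?z = "u *\<^sub>R y + v *\<^sub>R y'"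
    show "?z \<in> D"
      using convex_on_imp_convex[OF f] y uv by (simp add: convex_def)
    have "?z - (u *\<^sub>R d + v *\<^sub>R d') = u *\<^sub>R (y - d) + v *\<^sub>R (y' - d')"
      by (simp add: algebra_simps)
    then have "h (?z - (u *\<^sub>R d + v *\<^sub>R d')) \<le> u * h (y - d) + v * h (y' - d')"
      using h uv by (simp add: convex_on_def)
    moreover have "f ?z \<le> u * f y + v * f y'"
      using f y uv by (simp add: convex_on_def)
    moreover have "u * (r - c) + v * (r' - c) = u * r + v * r' - c" for r r' c :: real
    proof -
      have "u * (r - c) + v * (r' - c) = u * r + v * r' - (u + v) * c"
        by (simp add: algebra_simps)
      then show ?thesis using uv(3) by simp
    qed
    ultimately show "f ?z + h (?z - (u *\<^sub>R d + v *\<^sub>R d')) - (f x + h x)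
      \<le> u * (f y + h (y - d) - (f x + h x)) + v * (f y' + h (y' - d') - (f x + h x))"
      by (simp add: distrib_left)
  qed
  obtain K where K: "convex_on UNIV K" "0 \<le> K 0"
    "\<And>y d. y \<in> D \<Longrightarrow> K d \<le> f y + h (y - d) - (f x + h x)"
    by (rule directed_infimum_convex[where F = "\<lambda>y d. f y + h (y - d) - (f x + h x)" and I = D])
      (use x min dir in auto)
  obtain g where g: "linear g" "\<And>d. g d \<le> K d"
    using Hahn_Banach_convex[OF K(1,2)] by blast
  have bound: "g d \<le> f y + h (y - d) - (f x + h x)" if "y \<in> D" for y d
    using g(2) K(3)[OF that] by (rule order_trans)
  show thesis
  proof
    show "f x + g (y - x) \<le> f y" if "y \<in> D" for y
      using bound[OF that, of "y - x"] by simp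
    show "h x - g (y - x) \<le> h y" for y
      using bound[OF x, of "x - y"] linear_diff[OF g(1), of x y] linear_diff[OF g(1), of y x] by simp
  qed (rule g(1))
qed

section \<open>Ekeland's variational principle\<close>

text \<open>Write \<open>S x\<close> for the set of points that undercut \<open>x\<close> by the required amount. These
  sets are closed and nested along a sequence \<open>X\<close> in which each term is an almost minimiser of \<open>f\<close> on the
  set of its predecessor, so their diameters shrink to \<open>0\<close>. Their only common point \<open>a\<close> cannot be
  undercut: a point of \<open>S a\<close> would lie in all of them.\<close>

lemma Ekeland_variational_principle:
  fixes f :: "'a::complete_space \<Rightarrow> real"
  assumes epi: "closed {(x, r). x \<in> D \<and> f x \<le> r}" and ne: "D \<noteq> {}"
    and bdd: "\<And>x. x \<in> D \<Longrightarrow> b \<le> f x" and e: "0 < e"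
  obtains x where "x \<in> D" "\<And>y. y \<in> D \<Longrightarrow> f x \<le> f y + e * dist x y"
proof -
  define S where "S x = {y \<in> D. f y + e * dist x y \<le> f x}" for x
  have closed_S: "closed (S x)" for x
  proof -
    have "S x = (\<lambda>y. (y, f x - e * dist x y)) -` {(x, r). x \<in> D \<and> f x \<le> r}"
      by (auto simp: S_def algebra_simps)
    then show ?thesis
      by (simp only:) (intro closed_vimage epi continuous_intros)
  qed
  have refl: "x \<in> S x" if "x \<in> D" for x
    using that by (simp add: S_def)
  have trans: "S y \<subseteq> S x" if "y \<in> S x" for x y
  proof
    fix z
    assume z: "z \<in> S y"
    have "e * dist x z \<le> e * dist x y + e * dist y z"
      using e dist_triangle[of x z y] by (simp flip: distrib_left)
    with z that show "z \<in> S x" by (auto simp: S_def)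
  qed
  have near_min: "\<exists>y. y \<in> D \<and> y \<in> S x \<and> (\<forall>z\<in>S x. f y \<le> f z + (1/2) ^ n)" if x: "x \<in> D" for x and n :: nat
  proof -
    have bd: "bdd_below (f ` S x)" using bdd by (intro bdd_belowI2) (auto simp: S_def)
    obtain y where y: "y \<in> S x" "f y < (INF z\<in>S x. f z) + (1/2) ^ n"
      using cINF_less_iff[OF _ bd, of "(INF z\<in>S x. f z) + (1/2) ^ n"] refl[OF x] by auto
    have "f y \<le> f z + (1/2) ^ n" if "z \<in> S x" for z
      using y(2) cINF_lower[OF bd that] by simp
    with y(1) show ?thesis by (auto simp: S_def)
  qed
  obtain x0 where x0: "x0 \<in> D" using ne by blast
  obtain X where X: "\<And>n. X n \<in> D" "\<And>n. X (Suc n) \<in> S (X n)"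
    and near: "\<And>n z. z \<in> S (X n) \<Longrightarrow> f (X (Suc n)) \<le> f z + (1/2) ^ n"
    using dependent_nat_choice[of "\<lambda>_ x. x \<in> D" "\<lambda>n x y. y \<in> S x \<and> (\<forall>z\<in>S x. f y \<le> f z + (1/2) ^ n)"]
      x0 near_min by metis
  have "\<exists>a. \<Inter>(range (\<lambda>n. S (X (Suc n)))) = {a}"
  proof (rule decreasing_closed_nest_sing)
    show "S (X (Suc n)) \<noteq> {}" for n using refl[OF X(1)] by blast
    show "S (X (Suc n)) \<subseteq> S (X (Suc m))" if "m \<le> n" for m n
      using that by (rule lift_Suc_antimono_le[rotated]) (use trans X(2) in blast)
    fix d :: real
    assume d: "0 < d"
    obtain n where n: "(1/2) ^ n < e * d / 2"
      using real_arch_pow_inv[of "e * d / 2" "1/2"] d e by auto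
    have small: "dist (X (Suc n)) y < d / 2" if y: "y \<in> S (X (Suc n))" for y
    proof -
      have "y \<in> S (X n)" using trans X(2) y by blast
      from near[OF this] y have "e * dist (X (Suc n)) y \<le> (1/2) ^ n" by (simp add: S_def)
      also note n
      finally show ?thesis using e by simp
    qed
    have "dist y z < d" if "y \<in> S (X (Suc n))" "z \<in> S (X (Suc n))" for y z
      using small[OF that(1)] small[OF that(2)] by (rule dist_triangle_half_r)
    then show "\<exists>n. \<forall>y\<in>S (X (Suc n)). \<forall>z\<in>S (X (Suc n)). dist y z < d" by blast
  qed (rule closed_S)
  then obtain a where a: "\<Inter>(range (\<lambda>n. S (X (Suc n)))) = {a}" by blast
  then have aS: "a \<in> S (X (Suc n))" for n by auto
  have "f a \<le> f y + e * dist a y" if y: "y \<in> D" for y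
  proof (rule ccontr)
    assume neg: "\<not> f a \<le> f y + e * dist a y"
    then have "y \<in> S a" using y by (simp add: S_def)
    then have "y \<in> \<Inter>(range (\<lambda>n. S (X (Suc n))))" using trans[OF aS] by blast
    then show False using a neg by simp
  qed
  moreover have "a \<in> D" using aS by (auto simp: S_def)
  ultimately show thesis using that by blast
qed

section \<open>Approximate resolvents of the subdifferential\<close>

text \<open>An affine minorant would need a separation argument; a cone is enough to make the quadratically
  perturbed function bounded below. Closedness of the epigraph gives \<open>f \<ge> f c - 1\<close> on some ball around \<open>c\<close>,
  and convexity propagates this along rays from \<open>c\<close>.\<close>

lemma convex_conic_lower_bound:
  fixes f :: "'a::real_normed_vector \<Rightarrow> real"
  assumes conv: "convex_on D f" and epi: "closed {(x, r). x \<in> D \<and> f x \<le> r}" and c: "c \<in> D"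
  obtains L where "0 \<le> L" "\<And>y. y \<in> D \<Longrightarrow> f c - 1 - L * norm (y - c) \<le> f y"
proof -
  let ?Z = "(\<lambda>z. (z, f c - 1)) -` {(x, r). x \<in> D \<and> f x \<le> r}"
  have "closed ?Z" by (intro closed_vimage epi continuous_intros)
  then have "open (- ?Z)" by (rule open_Compl)
  moreover have "c \<in> - ?Z" by simp
  ultimately obtain r where r: "0 < r" "ball c r \<subseteq> - ?Z"
    using open_contains_ball by blast
  then have low: "f c - 1 \<le> f z" if "z \<in> D" "dist c z < r" for z
    using that by force
  show thesis
  proof
    show "0 \<le> 2 / r" using r by simp
    fix y
    assume y: "y \<in> D"
    show "f c - 1 - 2 / r * norm (y - c) \<le> f y"
    proof (cases "norm (y - c) < r")
      case True
      then have "f c - 1 \<le> f y" using y by (intro low) (auto simp: dist_norm norm_minus_commute)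
      moreover have "0 \<le> 2 / r * norm (y - c)" using r by simp
      ultimately show ?thesis by linarith
    next
      case False
      \<comment> \<open>This \<open>t\<close> puts the convex combination at distance \<open>r / 2\<close> from \<open>c\<close>, inside the ball.\<close>
      define t where "t = r / (2 * norm (y - c))"
      have n: "0 < norm (y - c)" using False r by linarith
      have t: "0 < t" "t \<le> 1" using False r n by (auto simp: t_def field_simps)
      let ?z = "(1 - t) *\<^sub>R c + t *\<^sub>R y"
      have "dist c ?z = t * norm (y - c)"
      proof -
        have "c - ?z = - (t *\<^sub>R (y - c))" by (simp add: algebra_simps)
        then show ?thesis using t by (simp add: dist_norm)
      qed
      also have "\<dots> < r" using r n by (simp add: t_def)
      finally have "f c - 1 \<le> f ?z"
        using convex_on_imp_convex[OF conv] c y t by (intro low) (auto simp: convex_def)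
      also have "\<dots> \<le> (1 - t) * f c + t * f y"
        using conv t c y by (intro convex_onD) auto
      finally have "- 1 / t \<le> f y - f c"
        using t by (simp add: field_simps)
      moreover have "- 1 / t = - (2 / r * norm (y - c))"
        using n r by (simp add: t_def)
      ultimately show ?thesis by simp
    qed
  qed
qed

lemma le_from_vanishing_error:
  fixes a b c :: real
  assumes "\<And>t. 0 < t \<Longrightarrow> t < 1 \<Longrightarrow> a \<le> b + t * c"
  shows "a \<le> b"
proof (rule tendsto_lowerbound)
  show "((\<lambda>t. b + t * c) \<longlongrightarrow> b) (at_right 0)"
    by (auto intro!: tendsto_eq_intros)
  show "\<forall>\<^sub>F t in at_right 0. a \<le> b + t * c"
    using assms by (auto simp: eventually_at_right_field intro!: exI[of _ 1])
qed simp

lemma convex_norm_square: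
  fixes p :: "'a::real_normed_vector"
  shows "convex_on UNIV (\<lambda>y. (norm (y - p))\<^sup>2)"
  unfolding convex_on_def
proof (intro conjI ballI allI impI)
  fix x y :: 'a and u v :: real
  assume uv: "0 \<le> u" "0 \<le> v" "u + v = 1"
  have "dist p (u *\<^sub>R x + v *\<^sub>R y) \<le> u * dist p x + v * dist p y"
    using convex_on_dist[of UNIV p] uv by (simp add: convex_on_def)
  then have "(norm (u *\<^sub>R x + v *\<^sub>R y - p))\<^sup>2 \<le> (u * norm (x - p) + v * norm (y - p))\<^sup>2"
    by (intro power_mono) (simp_all add: dist_norm norm_minus_commute)
  also have "\<dots> \<le> u * (norm (x - p))\<^sup>2 + v * (norm (y - p))\<^sup>2"
    using convex_power2 uv by (simp add: convex_on_def)
  finally show "(norm (u *\<^sub>R x + v *\<^sub>R y - p))\<^sup>2 \<le> u * (norm (x - p))\<^sup>2 + v * (norm (y - p))\<^sup>2" .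
qed simp

lemma convex_on_affine_blinfun:
  fixes w :: "'a::real_normed_vector \<Rightarrow>\<^sub>L real"
  shows "convex_on UNIV (\<lambda>y. - w (y - p))"
  unfolding convex_on_def
proof (intro conjI ballI allI impI)
  fix x y :: 'a and u v :: real
  assume uv: "0 \<le> u" "0 \<le> v" "u + v = 1"
  have "w p = u * w p + v * w p" using uv(3) by (metis distrib_right mult_1)
  then show "- w (u *\<^sub>R x + v *\<^sub>R y - p) \<le> u * - w (x - p) + v * - w (y - p)"
    by (simp add: blinfun.diff_right blinfun.add_right blinfun.scaleR_right algebra_simps)
qed simp

text \<open>Up to \<open>\<epsilon>\<close>, the pair \<open>(x, u)\<close> solves \<open>w \<in> \<partial>f(x) + J(x - p)\<close> with \<open>J\<close> the duality mapping, the
  subdifferential of \<open>1/2 \<parallel>\<cdot>\<parallel>\<^sup>2\<close>. For an exact solution the last two estimates would be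
  \<open>\<parallel>u - w\<parallel> = \<parallel>x - p\<parallel>\<close> and \<open>(u - w) (x - p) = - \<parallel>x - p\<parallel>\<^sup>2\<close>. They are read off from the
  subgradient inequality for the perturbation by moving a short distance \<open>t\<close>: towards \<open>p\<close> for the pairing, in an
  arbitrary direction for the norm.\<close>

lemma approximate_resolvent:
  fixes f :: "'a::banach \<Rightarrow> real" and p :: 'a and w :: "'a dual"
  assumes conv: "convex_on D f" and epi: "closed {(x, r). x \<in> D \<and> f x \<le> r}"
    and ne: "D \<noteq> {}" and e: "0 < e"
  obtains x u where "x \<in> D" "\<And>y. y \<in> D \<Longrightarrow> f x + blinfun_apply u (y - x) \<le> f y"
    "norm (u - w) \<le> norm (x - p) + e"
    "blinfun_apply (u - w) (x - p) \<le> e * norm (x - p) - (norm (x - p))\<^sup>2"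
proof -
  define q where "q y = 1/2 * (norm (y - p))\<^sup>2 + - w (y - p)" for y
  have conv_q: "convex_on UNIV q"
    unfolding q_def by (intro convex_on_add convex_on_cmul convex_norm_square convex_on_affine_blinfun) simp
  have "{(y, r). y \<in> D \<and> f y + q y \<le> r} = (\<lambda>(y, r). (y, r - q y)) -` {(x, r). x \<in> D \<and> f x \<le> r}"
    by auto
  moreover have "closed \<dots>"
    unfolding case_prod_beta q_def by (intro closed_vimage continuous_intros epi[unfolded case_prod_beta])
  ultimately have epi': "closed {(y, r). y \<in> D \<and> f y + q y \<le> r}" by simp
  obtain c where c: "c \<in> D" using ne by blast
  obtain L where L: "0 \<le> L" "\<And>y. y \<in> D \<Longrightarrow> f c - 1 - L * norm (y - c) \<le> f y"
    using convex_conic_lower_bound[OF conv epi c] by blast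
  have bdd: "f c - 1 - L * norm (p - c) - (L + norm w)\<^sup>2 / 2 \<le> f y + q y" if y: "y \<in> D" for y
  proof -
    let ?n = "norm (y - p)"
    have "L * norm (y - c) \<le> L * (?n + norm (p - c))"
      using L(1) norm_triangle_ineq[of "y - p" "p - c"] by (intro mult_left_mono) auto
    moreover have "w (y - p) \<le> norm w * ?n"
      using norm_blinfun[of w "y - p"] by simp
    \<comment> \<open>Completing the square: the quadratic term absorbs the linear decrease of cone and functional.\<close>
    moreover have "0 \<le> (?n - (L + norm w))\<^sup>2" by simp
    then have "(L + norm w) * ?n - (L + norm w)\<^sup>2 / 2 \<le> 1/2 * ?n\<^sup>2"
      by (simp add: power2_diff algebra_simps)
    ultimately show ?thesis
      using L(2)[OF y] unfolding q_def by (simp add: distrib_left distrib_right)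
  qed
  obtain x where x: "x \<in> D" "\<And>y. y \<in> D \<Longrightarrow> f x + q x \<le> f y + q y + e * dist x y"
    using Ekeland_variational_principle[OF epi' ne bdd e] by blast
  let ?h = "\<lambda>y. q y + e * dist x y"
  have conv_h: "convex_on UNIV ?h"
    using e by (intro convex_on_add conv_q convex_on_cmul convex_on_dist) auto
  have min_h: "f x + ?h x \<le> f y + ?h y" if "y \<in> D" for y
    using x(2)[OF that] by simp
  obtain g where g: "linear g" "\<And>y. y \<in> D \<Longrightarrow> f x + g (y - x) \<le> f y"
    "\<And>y. ?h x - g (y - x) \<le> ?h y"
    using convex_sandwich[OF conv conv_h x(1) min_h] by blast
  define s where "s = x - p"
  define v where "v d = g d - w d" for d
  have v_scale: "v (t *\<^sub>R d) = t * v d" for t d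
    using linear_scale[OF g(1)] by (simp add: v_def blinfun.scaleR_right algebra_simps)
  have v_lower: "- v d \<le> 1/2 * ((norm (s + d))\<^sup>2 - (norm s)\<^sup>2) + e * norm d" for d
    using g(3)[of "x + d"]
    by (simp add: q_def s_def v_def dist_norm blinfun.add_right blinfun.diff_right algebra_simps)
  have v_s: "v s \<le> e * norm s - (norm s)\<^sup>2"
  proof (rule le_from_vanishing_error)
    fix t :: real
    assume t: "0 < t" "t < 1"
    have "s + (- t) *\<^sub>R s = (1 - t) *\<^sub>R s" by (simp add: algebra_simps)
    then have "norm (s + (- t) *\<^sub>R s) = (1 - t) * norm s" using t by simp
    then have "t * v s \<le> 1/2 * (((1 - t) * norm s)\<^sup>2 - (norm s)\<^sup>2) + e * (t * norm s)"
      using v_lower[of "(- t) *\<^sub>R s"] v_scale[of "- t" s] t by simp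
    also have "\<dots> = t * (e * norm s - (norm s)\<^sup>2 + t * ((norm s)\<^sup>2 / 2))"
      by (simp add: power2_eq_square field_simps)
    finally show "v s \<le> e * norm s - (norm s)\<^sup>2 + t * ((norm s)\<^sup>2 / 2)"
      using t by simp
  qed
  have v_below: "- v d \<le> (norm s + e) * norm d" for d
  proof (rule le_from_vanishing_error)
    fix t :: real
    assume t: "0 < t" "t < 1"
    have "norm (s + t *\<^sub>R d) \<le> norm s + t * norm d"
      using norm_triangle_ineq[of s "t *\<^sub>R d"] t by simp
    then have sq: "(norm (s + t *\<^sub>R d))\<^sup>2 \<le> (norm s + t * norm d)\<^sup>2"
      by (intro power_mono) auto
    have "t * - v d = - v (t *\<^sub>R d)" by (simp add: v_scale)
    also have "\<dots> \<le> 1/2 * ((norm (s + t *\<^sub>R d))\<^sup>2 - (norm s)\<^sup>2) + e * norm (t *\<^sub>R d)"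
      by (rule v_lower)
    also have "\<dots> \<le> 1/2 * ((norm s + t * norm d)\<^sup>2 - (norm s)\<^sup>2) + e * (t * norm d)"
      using t e by (intro add_mono mult_left_mono diff_mono sq) auto
    also have "\<dots> = t * ((norm s + e) * norm d + t * ((norm d)\<^sup>2 / 2))"
      by (simp add: power2_eq_square field_simps)
    finally show "- v d \<le> (norm s + e) * norm d + t * ((norm d)\<^sup>2 / 2)"
      using t by (simp only: mult_le_cancel_left_pos)
  qed
  have v_norm: "\<bar>v d\<bar> \<le> (norm s + e) * norm d" for d
    using v_below[of d] v_below[of "- d"] v_scale[of "- 1" d] by simp
  have "bounded_linear v"
  proof (rule bounded_linear_intro)
    show "v (a + b) = v a + v b" for a b
      using linear_add[OF g(1)] by (simp add: v_def blinfun.add_right)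
    show "norm (v d) \<le> norm d * (norm s + e)" for d
      using v_norm[of d] by (simp add: mult.commute)
  qed (simp add: v_scale)
  then have v_apply: "blinfun_apply (Blinfun v) = v"
    by (rule bounded_linear_Blinfun_apply)
  show thesis
  proof
    show "f x + blinfun_apply (w + Blinfun v) (y - x) \<le> f y" if "y \<in> D" for y
      using g(2)[OF that] by (simp add: blinfun.add_left v_apply v_def)
    show "norm (w + Blinfun v - w) \<le> norm (x - p) + e"
      using v_norm e by (auto simp: v_apply s_def intro!: norm_blinfun_bound)
    show "blinfun_apply (w + Blinfun v - w) (x - p) \<le> e * norm (x - p) - (norm (x - p))\<^sup>2"
      using v_s by (simp add: v_apply s_def)
  qed (rule x(1))
qed

section \<open>Maximality\<close>

text \<open>Testing the monotone relation against approximate resolvents at \<open>(p, w)\<close> cancels the quadratic term and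
  leaves \<open>\<parallel>x - p\<parallel>\<^sup>2 \<le> \<epsilon> \<parallel>x - p\<parallel>\<close>; the limit is then taken inside the closed epigraph, which also
  yields \<open>p \<in> D\<close>.\<close>

lemma monotonically_related_subgradient:
  fixes f :: "'a::banach \<Rightarrow> real" and p :: 'a and w :: "'a dual"
  assumes conv: "convex_on D f" and epi: "closed {(x, r). x \<in> D \<and> f x \<le> r}"
    and ne: "D \<noteq> {}"
    and rel: "\<And>x u. x \<in> D \<Longrightarrow> (\<And>y. y \<in> D \<Longrightarrow> f x + blinfun_apply u (y - x) \<le> f y) \<Longrightarrow>
      0 \<le> blinfun_apply (u - w) (x - p)"
  shows "p \<in> D" and "\<And>y. y \<in> D \<Longrightarrow> f p + blinfun_apply w (y - p) \<le> f y"
proof -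
  define e where "e n = inverse (real (Suc n))" for n
  have e: "0 < e n" for n by (simp add: e_def)
  have e0: "e \<longlonglongrightarrow> 0" unfolding e_def by (rule LIMSEQ_inverse_real_of_nat)
  have "\<exists>x u. x \<in> D \<and> (\<forall>y\<in>D. f x + blinfun_apply u (y - x) \<le> f y) \<and>
      norm (x - p) \<le> e n \<and> norm (u - w) \<le> 2 * e n" for n
  proof -
    obtain x u where x: "x \<in> D" "\<And>y. y \<in> D \<Longrightarrow> f x + blinfun_apply u (y - x) \<le> f y"
      and n: "norm (u - w) \<le> norm (x - p) + e n"
      and a: "blinfun_apply (u - w) (x - p) \<le> e n * norm (x - p) - (norm (x - p))\<^sup>2"
      using approximate_resolvent[OF conv epi ne e] by blast
    have "norm (x - p) * norm (x - p) \<le> e n * norm (x - p)"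
      using rel[OF x] a by (simp add: power2_eq_square)
    then have "norm (x - p) \<le> e n"
      using e[of n] by (cases "norm (x - p) = 0") auto
    with x n show ?thesis by force
  qed
  then obtain x u where x: "\<And>n. x n \<in> D"
    and sub: "\<And>n y. y \<in> D \<Longrightarrow> f (x n) + blinfun_apply (u n) (y - x n) \<le> f y"
    and xn: "\<And>n. norm (x n - p) \<le> e n" and un: "\<And>n. norm (u n - w) \<le> 2 * e n"
    by metis
  have x_lim: "x \<longlonglongrightarrow> p"
    using Lim_null_comparison[OF always_eventually[OF allI[OF xn]] e0] by (simp add: LIM_zero_iff)
  have "(\<lambda>n. 2 * e n) \<longlonglongrightarrow> 0" using tendsto_mult_right_zero[OF e0] .
  then have u_lim: "u \<longlonglongrightarrow> w"
    by (rule LIM_zero_cancel[OF Lim_null_comparison[OF always_eventually[OF allI[OF un]]]])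
  have lim: "p \<in> D \<and> f p \<le> f y - blinfun_apply w (y - p)" if y: "y \<in> D" for y
  proof -
    have "(\<lambda>n. (x n, f y - blinfun_apply (u n) (y - x n))) \<longlonglongrightarrow> (p, f y - blinfun_apply w (y - p))"
      by (intro tendsto_intros x_lim u_lim)
    then have "(p, f y - blinfun_apply w (y - p)) \<in> {(x, r). x \<in> D \<and> f x \<le> r}"
      by (rule closed_sequentially[OF epi, rotated]) (use x sub[OF y] in \<open>auto simp: algebra_simps\<close>)
    then show ?thesis by simp
  qed
  show "p \<in> D" using lim ne by blast
  show "f p + blinfun_apply w (y - p) \<le> f y" if "y \<in> D" for y
    using lim[OF that] by simp
qed

text \<open>The limit inferior at \<open>x\<close> ignores the value at \<open>x\<close> itself, but a sequence converging to \<open>x\<close> may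
  visit \<open>x\<close>; the bound \<open>c < \<phi> x\<close> covers those terms.\<close>

lemma lower_semicontinuous_closed_epigraph:
  fixes \<phi> :: "'a::metric_space \<Rightarrow> ereal"
  assumes lsc: "lower_semicontinuous \<phi>"
  shows "closed {(x, r). \<phi> x \<le> ereal r}"
  unfolding closed_sequential_limits
proof (intro allI impI)
  fix z l
  assume z: "(\<forall>n. z n \<in> {(x, r). \<phi> x \<le> ereal r}) \<and> z \<longlonglongrightarrow> l"
  obtain x r where l: "l = (x, r)" by fastforce
  have zx: "(\<lambda>n. fst (z n)) \<longlonglongrightarrow> x" and zr: "(\<lambda>n. snd (z n)) \<longlonglongrightarrow> r"
    using z tendsto_fst[of z l] tendsto_snd[of z l] by (auto simp: l)
  have "\<phi> x \<le> ereal r"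
  proof (rule ccontr)
    assume "\<not> \<phi> x \<le> ereal r"
    then obtain c where c: "ereal r < ereal c" "ereal c < \<phi> x"
      using ereal_dense2[of "ereal r" "\<phi> x"] unfolding not_le by blast
    then have "ereal c < Liminf (at x) \<phi>"
      using lsc by (auto simp: lower_semicontinuous_def intro: less_le_trans)
    then have "\<forall>\<^sub>F y in nhds x. ereal c < \<phi> y"
      using c by (auto simp: eventually_nhds_conv_at dest: less_LiminfD)
    then have "\<forall>\<^sub>F n in sequentially. ereal c < \<phi> (fst (z n))"
      using zx by (auto simp: filterlim_iff)
    then have "\<forall>\<^sub>F n in sequentially. c \<le> snd (z n)"
    proof eventually_elim
      case (elim n)
      moreover have "\<phi> (fst (z n)) \<le> ereal (snd (z n))" using z by (auto simp: case_prod_beta)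
      ultimately have "ereal c < ereal (snd (z n))" by (rule less_le_trans)
      then show ?case by simp
    qed
    then have "c \<le> r" using zr by (intro tendsto_lowerbound) auto
    then show False using c by simp
  qed
  then show "l \<in> {(x, r). \<phi> x \<le> ereal r}" by (simp add: l)
qed

lemma subdifferential_monotone:
  assumes fin: "\<And>x u. u \<in> subdifferential \<phi> x \<Longrightarrow> \<bar>\<phi> x\<bar> \<noteq> \<infinity>"
  shows "monotone_operator (subdifferential \<phi>)"
proof -
  have "0 \<le> blinfun_apply (u - v) (x - y)"
    if u: "u \<in> subdifferential \<phi> x" and v: "v \<in> subdifferential \<phi> y" for x y u v
  proof -
    obtain a where a: "\<phi> x = ereal a"
      using fin[OF u] by (rule abs_neq_infinity_cases)
    obtain b where b: "\<phi> y = ereal b"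
      using fin[OF v] by (rule abs_neq_infinity_cases)
    have "ereal (blinfun_apply u (y - x)) + \<phi> x \<le> \<phi> y"
      "ereal (blinfun_apply v (x - y)) + \<phi> y \<le> \<phi> x"
      using u v by (auto simp: subdifferential_def)
    then show ?thesis
      by (simp add: a b blinfun.diff_left blinfun.diff_right)
  qed
  then show ?thesis by (auto simp: monotone_operator_def operator_graph_def)
qed

theorem theorem1:
  fixes \<phi> :: "'a::banach \<Rightarrow> ereal"
  assumes "never_minus_infinity \<phi>"
    and "proper_function \<phi>"
    and "convex_function \<phi>"
    and "lower_semicontinuous \<phi>"
  shows "proper_operator (subdifferential \<phi>) \<and> maximal_monotone_operator (subdifferential \<phi>)"
proof -
  define D where "D = {x. \<phi> x < \<infinity>}"
  define f where "f x = real_of_ereal (\<phi> x)" for x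
  have \<phi>_D: "\<phi> x = ereal (f x)" if "x \<in> D" for x
    using that assms(1) by (cases "\<phi> x") (auto simp: D_def f_def never_minus_infinity_def)
  have \<phi>_not_D: "\<phi> x = \<infinity>" if "x \<notin> D" for x
    using that by (simp add: D_def)
  have ne: "D \<noteq> {}"
    using assms(2) by (simp add: proper_function_def D_def)
  have conv: "convex_on D f"
  proof -
    have *: "u *\<^sub>R x + v *\<^sub>R y \<in> D \<and> f (u *\<^sub>R x + v *\<^sub>R y) \<le> u * f x + v * f y"
      if "x \<in> D" "y \<in> D" and uv: "0 \<le> u" "0 \<le> v" "u + v = 1" for x y u v
    proof -
      have le: "\<phi> (u *\<^sub>R x + v *\<^sub>R y) \<le> ereal (u * f x + v * f y)"
      proof -
        have "\<phi> (u *\<^sub>R x + v *\<^sub>R y) \<le> ereal u * \<phi> x + ereal v * \<phi> y"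
          using assms(3) uv unfolding convex_function_def by blast
        also have "\<dots> = ereal (u * f x + v * f y)"
          by (simp only: \<phi>_D[OF that(1)] \<phi>_D[OF that(2)] times_ereal.simps plus_ereal.simps)
        finally show ?thesis .
      qed
      then have "u *\<^sub>R x + v *\<^sub>R y \<in> D"
        by (auto simp: D_def intro: le_less_trans)
      with le show ?thesis by (simp add: \<phi>_D)
    qed
    then show ?thesis by (simp add: convex_on_def convex_def)
  qed
  have "x \<in> D \<and> f x \<le> r \<longleftrightarrow> \<phi> x \<le> ereal r" for x r
    by (cases "x \<in> D") (simp_all add: \<phi>_D \<phi>_not_D)
  then have epi: "closed {(x, r). x \<in> D \<and> f x \<le> r}"
    using lower_semicontinuous_closed_epigraph[OF assms(4)] by simp
  \<comment> \<open>Outside \<open>D\<close> there are no subgradients: they would make \<open>\<phi>\<close> infinite everywhere.\<close>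
  have sub_iff: "u \<in> subdifferential \<phi> x \<longleftrightarrow>
      x \<in> D \<and> (\<forall>y\<in>D. f x + blinfun_apply u (y - x) \<le> f y)" for u x
  proof (cases "x \<in> D")
    case True
    have "ereal (blinfun_apply u (y - x)) + \<phi> x \<le> \<phi> y \<longleftrightarrow>
        (y \<in> D \<longrightarrow> f x + blinfun_apply u (y - x) \<le> f y)" for y
      using True by (cases "y \<in> D") (auto simp: \<phi>_D \<phi>_not_D add.commute)
    then show ?thesis using True by (auto simp: subdifferential_def)
  next
    case False
    obtain c where "c \<in> D" using ne by blast
    then show ?thesis using False \<phi>_not_D[OF False] \<phi>_D[of c]
      by (auto simp: subdifferential_def intro: exI[of _ c])
  qed
  have mono: "monotone_operator (subdifferential \<phi>)"
    by (rule subdifferential_monotone) (auto simp: sub_iff \<phi>_D)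
  obtain x u where "x \<in> D" "\<And>y. y \<in> D \<Longrightarrow> f x + blinfun_apply u (y - x) \<le> f y"
    using approximate_resolvent[OF conv epi ne zero_less_one] by blast
  then have "u \<in> subdifferential \<phi> x"
    by (simp add: sub_iff)
  then have proper: "proper_operator (subdifferential \<phi>)"
    by (auto simp: proper_operator_def)
  have "operator_graph B \<subseteq> operator_graph (subdifferential \<phi>)"
    if B: "monotone_operator B" "operator_graph (subdifferential \<phi>) \<subseteq> operator_graph B" for B
  proof clarify
    fix p w
    assume pw: "(p, w) \<in> operator_graph B"
    have rel: "0 \<le> blinfun_apply (u - w) (x - p)"
      if "x \<in> D" "\<And>y. y \<in> D \<Longrightarrow> f x + blinfun_apply u (y - x) \<le> f y" for x u
    proof -
      have xu: "(x, u) \<in> operator_graph B"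
        using that B(2) by (auto simp: operator_graph_def sub_iff)
      show ?thesis
        using bspec[OF bspec[OF B(1)[unfolded monotone_operator_def] xu, unfolded prod.case] pw]
        unfolding prod.case .
    qed
    show "(p, w) \<in> operator_graph (subdifferential \<phi>)"
      using monotonically_related_subgradient[OF conv epi ne rel]
      by (auto simp: operator_graph_def sub_iff)
  qed
  then have "maximal_monotone_operator (subdifferential \<phi>)"
    using mono by (auto simp: maximal_monotone_operator_def)
  with proper show ?thesis by blast
qed

end
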